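(* Let $k$ be a field. There exists a local $k$-algebra $R$ whose zero ideal is not arc closed.
   Context: Local rings are not assumed Noetherian. For a local $k$-algebra $(R,\mathfrak m)$ let $R_\infty$ be the $k$-algebra representing $A\mapsto\mathrm{Hom}_{k\text{-alg}}(R,A[[t]])$ on $k$-algebras (the coordinate ring of the arc space of $\mathrm{Spec}\,R$), with universal homomorphism $R\to R_\infty[[t]]$, $f\mapsto\sum_{i\ge0}D_i(f)t^i$; $R_\infty$ is an $R$-algebra via the ring homomorphism $D_0\colon R\to R_\infty$. For an ideal $\mathfrak a\subset R$ put $\mathfrak a_\infty:=(D_i(f)\mid f\in\mathfrak a,\ i\ge0)\subset R_\infty$. The arc closure of $\mathfrak a$ is $\mathfrak a^{\mathrm{ac}}:=\{f\in R\mid (f)_\infty\subset\mathfrak a_\infty+\mathfrak m R_\infty\}$, and $\mathfrak a$ is arc closed if $\mathfrak a=\mathfrak a^{\mathrm{ac}}$. *)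

theory Defs
  imports "HOL-Algebra.UnivPoly" "HOL-Algebra.Ideal"
begin

section \<open>Algebra homomorphisms and power series\<close>

definition alg_hom ::
  "('k, 'z) ring_scheme \<Rightarrow> ('k, 'a, 'm) module_scheme \<Rightarrow> ('k, 'b, 'n) module_scheme \<Rightarrow> ('a \<Rightarrow> 'b) set"
  where "alg_hom K A B = {h \<in> ring_hom A B.
    \<forall>a\<in>carrier K. \<forall>x\<in>carrier A. h (a \<odot>\<^bsub>A\<^esub> x) = a \<odot>\<^bsub>B\<^esub> h x}"

definition fps_algebra :: "('k, 'a, 'm) module_scheme \<Rightarrow> ('k, nat \<Rightarrow> 'a) module" where
  "fps_algebra A = \<lparr>
     carrier = {F. \<forall>n. F n \<in> carrier A},
     monoid.mult = (\<lambda>F G n. \<Oplus>\<^bsub>A\<^esub>i\<in>{..n}. F i \<otimes>\<^bsub>A\<^esub> G (n - i)),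
     one = (\<lambda>n. if n = 0 then \<one>\<^bsub>A\<^esub> else \<zero>\<^bsub>A\<^esub>),
     zero = (\<lambda>n. \<zero>\<^bsub>A\<^esub>),
     add = (\<lambda>F G n. F n \<oplus>\<^bsub>A\<^esub> G n),
     smult = (\<lambda>a F n. a \<odot>\<^bsub>A\<^esub> F n)\<rparr>"

lemma fps_algebra_simps:
  "F \<in> carrier (fps_algebra A) \<longleftrightarrow> (\<forall>n. F n \<in> carrier A)"
  "F \<otimes>\<^bsub>fps_algebra A\<^esub> G = (\<lambda>n. \<Oplus>\<^bsub>A\<^esub>i\<in>{..n}. F i \<otimes>\<^bsub>A\<^esub> G (n - i))"
  "\<one>\<^bsub>fps_algebra A\<^esub> = (\<lambda>n. if n = 0 then \<one>\<^bsub>A\<^esub> else \<zero>\<^bsub>A\<^esub>)"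
  "\<zero>\<^bsub>fps_algebra A\<^esub> = (\<lambda>n. \<zero>\<^bsub>A\<^esub>)"
  "F \<oplus>\<^bsub>fps_algebra A\<^esub> G = (\<lambda>n. F n \<oplus>\<^bsub>A\<^esub> G n)"
  "a \<odot>\<^bsub>fps_algebra A\<^esub> F = (\<lambda>n. a \<odot>\<^bsub>A\<^esub> F n)"
  by (simp_all add: fps_algebra_def)

text \<open>
  The \<open>n\<close>-th coefficient of a product only depends on the truncations of the factors, so
  associativity and commutativity are inherited from the polynomial ring \<^term>\<open>UP A\<close>.
\<close>

lemma fps_algebra_algebra:
  fixes A :: "('k, 'a, 'm) module_scheme"
  assumes "algebra K A"
  shows "algebra K (fps_algebra A)"
proof -
  interpret A: algebra K A by fact
  interpret P: UP_cring A "UP A"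
    by unfold_locales
  define tr where "tr N F = (\<lambda>i. if i \<le> N then F i else \<zero>\<^bsub>A\<^esub>)" for N :: nat and F :: "nat \<Rightarrow> 'a"
  define cv where "cv F G = (\<lambda>n. \<Oplus>\<^bsub>A\<^esub>i\<in>{..n}. F i \<otimes>\<^bsub>A\<^esub> G (n - i))" for F G :: "nat \<Rightarrow> 'a"
  have tr_up: "tr N F \<in> carrier (UP A)" if "\<And>n. F n \<in> carrier A" for N F
    using that by (auto simp: UP_def up_def tr_def intro!: exI[of _ N] bound.intro)
  have up_mult: "p \<otimes>\<^bsub>UP A\<^esub> q = cv p q" if "p \<in> carrier (UP A)" "q \<in> carrier (UP A)" for p q
    using that by (simp add: UP_def cv_def)
  have cv_closed: "cv F G n \<in> carrier A"
    if "\<And>n. F n \<in> carrier A" "\<And>n. G n \<in> carrier A" for F G n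
    unfolding cv_def using that by (intro A.M.finsum_closed) auto
  have tr_cl: "tr N F n \<in> carrier A" if "\<And>n. F n \<in> carrier A" for F N n
    using that by (simp add: tr_def)
  have cv_cong: "cv F G n = cv F' G' n"
    if "\<And>i. i \<le> n \<Longrightarrow> F i = F' i" "\<And>i. i \<le> n \<Longrightarrow> G i = G' i"
      "\<And>n. F' n \<in> carrier A" "\<And>n. G' n \<in> carrier A" for F G F' G' n
    unfolding cv_def using that by (intro A.M.finsum_cong') auto
  have cv_assoc: "cv (cv F G) H n = cv F (cv G H) n"
    if F: "\<And>n. F n \<in> carrier A" and G: "\<And>n. G n \<in> carrier A" and H: "\<And>n. H n \<in> carrier A"
    for F G H n
  proof -
    let ?f = "tr n F" and ?g = "tr n G" and ?h = "tr n H"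
    note cl = tr_cl[OF F] tr_cl[OF G] tr_cl[OF H]
    note up = tr_up[OF F] tr_up[OF G] tr_up[OF H]
    have "cv (cv F G) H n = cv (cv ?f ?g) ?h n"
      by (intro cv_cong cv_closed cl) (auto simp: tr_def)
    also have "cv (cv ?f ?g) ?h = (?f \<otimes>\<^bsub>UP A\<^esub> ?g) \<otimes>\<^bsub>UP A\<^esub> ?h"
      by (subst up_mult[symmetric], rule up, rule up, subst up_mult[symmetric])
        (auto intro: up P.UP_mult_closed)
    also have "\<dots> = ?f \<otimes>\<^bsub>UP A\<^esub> (?g \<otimes>\<^bsub>UP A\<^esub> ?h)"
      by (rule P.UP_m_assoc) (rule up)+
    also have "\<dots> = cv ?f (cv ?g ?h)"
      using up_mult[OF up(1) P.UP_mult_closed[OF up(2,3)]] up_mult[OF up(2,3)] by simp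
    also have "\<dots> n = cv F (cv G H) n"
      by (rule sym, intro cv_cong cv_closed cl) (auto simp: tr_def)
    finally show ?thesis .
  qed
  have cv_comm: "cv F G n = cv G F n"
    if F: "\<And>n. F n \<in> carrier A" and G: "\<And>n. G n \<in> carrier A" for F G n
  proof -
    have "cv F G n = cv (tr n F) (tr n G) n"
      by (intro cv_cong tr_cl F G) (auto simp: tr_def)
    also have "cv (tr n F) (tr n G) = cv (tr n G) (tr n F)"
      using P.UP_m_comm[OF tr_up[OF F] tr_up[OF G]] by (simp only: up_mult tr_up F G)
    also have "\<dots> n = cv G F n"
      by (rule sym, intro cv_cong tr_cl F G) (auto simp: tr_def)
    finally show ?thesis .
  qed
  have cv_one: "cv (\<lambda>n. if n = 0 then \<one>\<^bsub>A\<^esub> else \<zero>\<^bsub>A\<^esub>) F n = F n"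
    if F: "\<And>n. F n \<in> carrier A" for F n
  proof -
    have "cv (\<lambda>n. if n = 0 then \<one>\<^bsub>A\<^esub> else \<zero>\<^bsub>A\<^esub>) F n
        = (\<Oplus>\<^bsub>A\<^esub>i\<in>{..n}. if 0 = i then F n else \<zero>\<^bsub>A\<^esub>)"
      unfolding cv_def using F by (intro A.M.finsum_cong') auto
    also have "\<dots> = F n"
      using F by (subst A.M.finsum_singleton) auto
    finally show ?thesis .
  qed
  have cv_distr: "cv (\<lambda>n. F n \<oplus>\<^bsub>A\<^esub> G n) H n = cv F H n \<oplus>\<^bsub>A\<^esub> cv G H n"
    if "\<And>n. F n \<in> carrier A" "\<And>n. G n \<in> carrier A" "\<And>n. H n \<in> carrier A" for F G H n
    unfolding cv_def using that
    by (subst A.M.finsum_addf[symmetric]) (auto simp: A.l_distr intro!: A.M.finsum_cong')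
  have cv_smult: "cv (\<lambda>n. a \<odot>\<^bsub>A\<^esub> F n) G n = a \<odot>\<^bsub>A\<^esub> cv F G n"
    if "a \<in> carrier K" "\<And>n. F n \<in> carrier A" "\<And>n. G n \<in> carrier A" for a F G n
    unfolding cv_def using that
    by (subst A.finsum_smult_ldistr) (auto simp: A.smult_assoc2 intro!: A.M.finsum_cong')
  have "F \<otimes>\<^bsub>fps_algebra A\<^esub> G = (\<lambda>n. cv F G n)" for F G
    by (simp add: fps_algebra_simps cv_def)
  note fs = fps_algebra_simps(1,3-6) this
  have "abelian_group (fps_algebra A)"
  proof (rule abelian_groupI)
    fix F assume "F \<in> carrier (fps_algebra A)"
    then show "\<exists>G\<in>carrier (fps_algebra A). G \<oplus>\<^bsub>fps_algebra A\<^esub> F = \<zero>\<^bsub>fps_algebra A\<^esub>"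
      by (intro bexI[of _ "\<lambda>n. \<ominus>\<^bsub>A\<^esub> F n"]) (auto simp: fs A.M.l_neg)
  qed (auto simp: fs A.M.a_assoc intro: A.M.a_comm)
  moreover have "comm_monoid (fps_algebra A)"
    by (rule comm_monoidI)
      (auto simp: fs cv_closed cv_assoc cv_one intro: cv_comm)
  ultimately have "cring (fps_algebra A)"
    by (rule cringI) (simp add: fs cv_distr)
  then show ?thesis
    by (intro algebraI A.R_cring)
      (auto simp: fs A.smult_l_distr A.smult_r_distr A.smult_assoc1
        cv_smult)
qed


section \<open>The arc algebra\<close>

text \<open>
  The representing algebra is presented by generators \<open>D i f\<close> and relations: it is the set of
  formal \<open>K\<close>-algebra expressions in the symbols \<^term>\<open>Gen f i\<close> (standing for the coefficient of
  \<open>t\<^sup>i\<close> in the image of \<open>f\<close>), modulo the congruence generated by the axioms of commutative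
  \<open>K\<close>-algebras and by the equations saying that \<open>f \<mapsto> \<Sum>i. D i f t\<^sup>i\<close> is a \<open>K\<close>-algebra homomorphism.
  That this algebra represents \<open>A \<mapsto> Hom (R, A[[t]])\<close> is proved below
  (\<open>arc_algebra_algebra\<close>, \<open>arc_D_alg_hom\<close>, \<open>arc_algebra_universal\<close>).
\<close>

datatype ('k, 'r) arc_term =
    Scalar 'k
  | Gen 'r nat
  | Add "('k, 'r) arc_term" "('k, 'r) arc_term"
  | Mul "('k, 'r) arc_term" "('k, 'r) arc_term"

primrec arc_sum :: "(nat \<Rightarrow> ('k, 'r) arc_term) \<Rightarrow> nat \<Rightarrow> ('k, 'r) arc_term" where
  "arc_sum T 0 = T 0"
| "arc_sum T (Suc n) = Add (T (Suc n)) (arc_sum T n)"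

inductive_set arc_terms ::
  "('k, 'z) ring_scheme \<Rightarrow> ('k, 'r, 'm) module_scheme \<Rightarrow> ('k, 'r) arc_term set"
  for K R where
  Scalar: "a \<in> carrier K \<Longrightarrow> Scalar a \<in> arc_terms K R"
| Gen: "f \<in> carrier R \<Longrightarrow> Gen f i \<in> arc_terms K R"
| Add: "t \<in> arc_terms K R \<Longrightarrow> u \<in> arc_terms K R \<Longrightarrow> Add t u \<in> arc_terms K R"
| Mul: "t \<in> arc_terms K R \<Longrightarrow> u \<in> arc_terms K R \<Longrightarrow> Mul t u \<in> arc_terms K R"

inductive arc_rel ::
  "('k, 'z) ring_scheme \<Rightarrow> ('k, 'r, 'm) module_scheme \<Rightarrow>
    ('k, 'r) arc_term \<Rightarrow> ('k, 'r) arc_term \<Rightarrow> bool"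
  for K R where
  refl: "t \<in> arc_terms K R \<Longrightarrow> arc_rel K R t t"
| sym: "arc_rel K R t u \<Longrightarrow> arc_rel K R u t"
| trans: "arc_rel K R t u \<Longrightarrow> arc_rel K R u v \<Longrightarrow> arc_rel K R t v"
| add_cong: "arc_rel K R t t' \<Longrightarrow> arc_rel K R u u' \<Longrightarrow> arc_rel K R (Add t u) (Add t' u')"
| mul_cong: "arc_rel K R t t' \<Longrightarrow> arc_rel K R u u' \<Longrightarrow> arc_rel K R (Mul t u) (Mul t' u')"
| add_assoc: "t \<in> arc_terms K R \<Longrightarrow> u \<in> arc_terms K R \<Longrightarrow> v \<in> arc_terms K R \<Longrightarrow>
    arc_rel K R (Add (Add t u) v) (Add t (Add u v))"
| add_comm: "t \<in> arc_terms K R \<Longrightarrow> u \<in> arc_terms K R \<Longrightarrow> arc_rel K R (Add t u) (Add u t)"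
| add_zero: "t \<in> arc_terms K R \<Longrightarrow> arc_rel K R (Add (Scalar \<zero>\<^bsub>K\<^esub>) t) t"
| add_neg: "t \<in> arc_terms K R \<Longrightarrow>
    arc_rel K R (Add (Mul (Scalar (\<ominus>\<^bsub>K\<^esub> \<one>\<^bsub>K\<^esub>)) t) t) (Scalar \<zero>\<^bsub>K\<^esub>)"
| mul_assoc: "t \<in> arc_terms K R \<Longrightarrow> u \<in> arc_terms K R \<Longrightarrow> v \<in> arc_terms K R \<Longrightarrow>
    arc_rel K R (Mul (Mul t u) v) (Mul t (Mul u v))"
| mul_comm: "t \<in> arc_terms K R \<Longrightarrow> u \<in> arc_terms K R \<Longrightarrow> arc_rel K R (Mul t u) (Mul u t)"
| mul_one: "t \<in> arc_terms K R \<Longrightarrow> arc_rel K R (Mul (Scalar \<one>\<^bsub>K\<^esub>) t) t"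
| distrib: "t \<in> arc_terms K R \<Longrightarrow> u \<in> arc_terms K R \<Longrightarrow> v \<in> arc_terms K R \<Longrightarrow>
    arc_rel K R (Mul (Add t u) v) (Add (Mul t v) (Mul u v))"
| scalar_add: "a \<in> carrier K \<Longrightarrow> b \<in> carrier K \<Longrightarrow>
    arc_rel K R (Scalar (a \<oplus>\<^bsub>K\<^esub> b)) (Add (Scalar a) (Scalar b))"
| scalar_mul: "a \<in> carrier K \<Longrightarrow> b \<in> carrier K \<Longrightarrow>
    arc_rel K R (Scalar (a \<otimes>\<^bsub>K\<^esub> b)) (Mul (Scalar a) (Scalar b))"
| gen_add: "f \<in> carrier R \<Longrightarrow> g \<in> carrier R \<Longrightarrow>
    arc_rel K R (Gen (f \<oplus>\<^bsub>R\<^esub> g) n) (Add (Gen f n) (Gen g n))"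
| gen_smult: "a \<in> carrier K \<Longrightarrow> f \<in> carrier R \<Longrightarrow>
    arc_rel K R (Gen (a \<odot>\<^bsub>R\<^esub> f) n) (Mul (Scalar a) (Gen f n))"
| gen_one: "arc_rel K R (Gen \<one>\<^bsub>R\<^esub> n) (Scalar (if n = 0 then \<one>\<^bsub>K\<^esub> else \<zero>\<^bsub>K\<^esub>))"
| gen_mult: "f \<in> carrier R \<Longrightarrow> g \<in> carrier R \<Longrightarrow>
    arc_rel K R (Gen (f \<otimes>\<^bsub>R\<^esub> g) n) (arc_sum (\<lambda>i. Mul (Gen f i) (Gen g (n - i))) n)"

definition arc_class ::
  "('k, 'z) ring_scheme \<Rightarrow> ('k, 'r, 'm) module_scheme \<Rightarrow>
    ('k, 'r) arc_term \<Rightarrow> ('k, 'r) arc_term set"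
  where "arc_class K R t = {u. arc_rel K R t u}"

definition arc_algebra ::
  "('k, 'z) ring_scheme \<Rightarrow> ('k, 'r, 'm) module_scheme \<Rightarrow> ('k, ('k, 'r) arc_term set) module"
  where "arc_algebra K R = \<lparr>
     carrier = arc_class K R ` arc_terms K R,
     monoid.mult = (\<lambda>X Y. \<Union>t\<in>X. \<Union>u\<in>Y. arc_class K R (Mul t u)),
     one = arc_class K R (Scalar \<one>\<^bsub>K\<^esub>),
     zero = arc_class K R (Scalar \<zero>\<^bsub>K\<^esub>),
     add = (\<lambda>X Y. \<Union>t\<in>X. \<Union>u\<in>Y. arc_class K R (Add t u)),
     smult = (\<lambda>a X. \<Union>t\<in>X. arc_class K R (Mul (Scalar a) t))\<rparr>"

definition arc_D ::
  "('k, 'z) ring_scheme \<Rightarrow> ('k, 'r, 'm) module_scheme \<Rightarrow> nat \<Rightarrow> 'r \<Rightarrow> ('k, 'r) arc_term set"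
  where "arc_D K R i f = arc_class K R (Gen f i)"

lemma arc_sum_in_terms:
  "(\<And>i. i \<le> n \<Longrightarrow> T i \<in> arc_terms K R) \<Longrightarrow> arc_sum T n \<in> arc_terms K R"
  by (induction n) (auto intro: arc_terms.intros)

lemma arc_rel_in_terms:
  assumes "algebra K R" "arc_rel K R t u"
  shows "t \<in> arc_terms K R \<and> u \<in> arc_terms K R"
proof -
  interpret algebra K R by fact
  show ?thesis
    using assms(2) by induction (auto intro!: arc_terms.intros arc_sum_in_terms)
qed

lemma arc_class_eqI: "arc_rel K R t u \<Longrightarrow> arc_class K R t = arc_class K R u"
  unfolding arc_class_def by (blast intro: arc_rel.sym arc_rel.trans)

lemma arc_algebra_simps:
  assumes "algebra K R"
  shows "carrier (arc_algebra K R) = arc_class K R ` arc_terms K R"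
    and "\<one>\<^bsub>arc_algebra K R\<^esub> = arc_class K R (Scalar \<one>\<^bsub>K\<^esub>)"
    and "\<zero>\<^bsub>arc_algebra K R\<^esub> = arc_class K R (Scalar \<zero>\<^bsub>K\<^esub>)"
    and "t \<in> arc_terms K R \<Longrightarrow> u \<in> arc_terms K R \<Longrightarrow>
      arc_class K R t \<otimes>\<^bsub>arc_algebra K R\<^esub> arc_class K R u = arc_class K R (Mul t u)"
    and "t \<in> arc_terms K R \<Longrightarrow> u \<in> arc_terms K R \<Longrightarrow>
      arc_class K R t \<oplus>\<^bsub>arc_algebra K R\<^esub> arc_class K R u = arc_class K R (Add t u)"
    and "a \<in> carrier K \<Longrightarrow> t \<in> arc_terms K R \<Longrightarrow>
      a \<odot>\<^bsub>arc_algebra K R\<^esub> arc_class K R t = arc_class K R (Mul (Scalar a) t)"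
proof -
  note [intro] = arc_rel.refl arc_terms.Scalar
  show "t \<in> arc_terms K R \<Longrightarrow> u \<in> arc_terms K R \<Longrightarrow>
      arc_class K R t \<otimes>\<^bsub>arc_algebra K R\<^esub> arc_class K R u = arc_class K R (Mul t u)"
    by (auto simp: arc_algebra_def arc_class_def intro: arc_rel.trans[OF mul_cong])
  show "t \<in> arc_terms K R \<Longrightarrow> u \<in> arc_terms K R \<Longrightarrow>
      arc_class K R t \<oplus>\<^bsub>arc_algebra K R\<^esub> arc_class K R u = arc_class K R (Add t u)"
    by (auto simp: arc_algebra_def arc_class_def intro: arc_rel.trans[OF add_cong])
  show "a \<in> carrier K \<Longrightarrow> t \<in> arc_terms K R \<Longrightarrow>
      a \<odot>\<^bsub>arc_algebra K R\<^esub> arc_class K R t = arc_class K R (Mul (Scalar a) t)"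
    by (auto simp: arc_algebra_def arc_class_def intro: arc_rel.trans[OF mul_cong])
qed (simp_all add: arc_algebra_def)

lemma arc_algebra_algebra:
  assumes "algebra K R"
  shows "algebra K (arc_algebra K R)"
proof -
  interpret algebra K R by fact
  note S = arc_algebra_simps[OF assms] and I = arc_rel.intros and W = arc_terms.intros
  note E = arc_class_eqI[of K R]
  let ?S = "arc_algebra K R"
  have ag: "abelian_group ?S"
  proof (rule abelian_groupI)
    fix x assume "x \<in> carrier ?S"
    then obtain t where t: "t \<in> arc_terms K R" "x = arc_class K R t" by (auto simp: S)
    show "\<exists>y\<in>carrier ?S. y \<oplus>\<^bsub>?S\<^esub> x = \<zero>\<^bsub>?S\<^esub>"
      by (rule bexI[of _ "arc_class K R (Mul (Scalar (\<ominus>\<^bsub>K\<^esub> \<one>\<^bsub>K\<^esub>)) t)"])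
        (use t in \<open>auto simp: S W del: equalityI intro!: E I imageI\<close>)
  qed (auto simp: S W del: equalityI intro!: E I(6-8))
  have cm: "comm_monoid ?S"
    by (rule comm_monoidI) (auto simp: S W del: equalityI intro!: E I(10-12))
  have cr: "cring ?S"
    by (rule cringI[OF ag cm]) (auto simp: S W del: equalityI intro!: E I(13))
  show ?thesis
  proof (rule algebraI[OF R_cring cr])
    fix a b x assume h: "a \<in> carrier K" "b \<in> carrier K" "x \<in> carrier ?S"
    then obtain t where t: "t \<in> arc_terms K R" "x = arc_class K R t" by (auto simp: S)
    have "arc_rel K R (Mul (Scalar (a \<oplus>\<^bsub>K\<^esub> b)) t) (Mul (Add (Scalar a) (Scalar b)) t)"
      using h t by (intro I(5) I(1) scalar_add)
    then have "arc_rel K R (Mul (Scalar (a \<oplus>\<^bsub>K\<^esub> b)) t) (Add (Mul (Scalar a) t) (Mul (Scalar b) t))"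
      by (rule arc_rel.trans) (use h t in \<open>auto intro!: I(13) W\<close>)
    then show "(a \<oplus>\<^bsub>K\<^esub> b) \<odot>\<^bsub>?S\<^esub> x = a \<odot>\<^bsub>?S\<^esub> x \<oplus>\<^bsub>?S\<^esub> b \<odot>\<^bsub>?S\<^esub> x"
      using h t by (auto simp: S W del: equalityI intro!: E)
    have "arc_rel K R (Mul (Scalar (a \<otimes>\<^bsub>K\<^esub> b)) t) (Mul (Mul (Scalar a) (Scalar b)) t)"
      using h t by (intro I(5) I(1) scalar_mul)
    then have "arc_rel K R (Mul (Scalar (a \<otimes>\<^bsub>K\<^esub> b)) t) (Mul (Scalar a) (Mul (Scalar b) t))"
      by (rule arc_rel.trans) (use h t in \<open>auto intro!: I(10) W\<close>)
    then show "(a \<otimes>\<^bsub>K\<^esub> b) \<odot>\<^bsub>?S\<^esub> x = a \<odot>\<^bsub>?S\<^esub> (b \<odot>\<^bsub>?S\<^esub> x)"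
      using h t by (auto simp: S W del: equalityI intro!: E)
  next
    fix a x y assume h: "a \<in> carrier K" "x \<in> carrier ?S" "y \<in> carrier ?S"
    then obtain t u where t: "t \<in> arc_terms K R" "x = arc_class K R t"
      "u \<in> arc_terms K R" "y = arc_class K R u" by (auto simp: S)
    have "arc_rel K R (Mul (Scalar a) (Add t u)) (Mul (Add t u) (Scalar a))"
      by (intro mul_comm W h t)
    moreover have "arc_rel K R (Mul (Add t u) (Scalar a)) (Add (Mul t (Scalar a)) (Mul u (Scalar a)))"
      by (intro distrib W h t)
    moreover have "arc_rel K R (Add (Mul t (Scalar a)) (Mul u (Scalar a)))
        (Add (Mul (Scalar a) t) (Mul (Scalar a) u))"
      by (intro add_cong mul_comm W h t)
    ultimately have "arc_rel K R (Mul (Scalar a) (Add t u)) (Add (Mul (Scalar a) t) (Mul (Scalar a) u))"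
      by (meson arc_rel.trans)
    then show "a \<odot>\<^bsub>?S\<^esub> (x \<oplus>\<^bsub>?S\<^esub> y) = a \<odot>\<^bsub>?S\<^esub> x \<oplus>\<^bsub>?S\<^esub> a \<odot>\<^bsub>?S\<^esub> y"
      using h t by (auto simp: S W del: equalityI intro!: E)
  qed (auto simp: S W del: equalityI intro!: E I(10,12))
qed

lemma arc_class_sum:
  assumes "algebra K R" "\<And>i. i \<le> n \<Longrightarrow> T i \<in> arc_terms K R"
  shows "arc_class K R (arc_sum T n)
    = (\<Oplus>\<^bsub>arc_algebra K R\<^esub>i\<in>{..n}. arc_class K R (T i))"
proof -
  interpret S: algebra K "arc_algebra K R" by (rule arc_algebra_algebra) fact
  note simps = arc_algebra_simps[OF assms(1)]
  show ?thesis
    using assms(2)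
  proof (induction n)
    case 0
    then show ?case by (simp add: simps(1) Pi_def)
  next
    case (Suc n)
    have "arc_class K R (arc_sum T (Suc n))
      = arc_class K R (T (Suc n)) \<oplus>\<^bsub>arc_algebra K R\<^esub> arc_class K R (arc_sum T n)"
      using Suc.prems by (simp add: simps(5) arc_sum_in_terms)
    also have "\<dots> = (\<Oplus>\<^bsub>arc_algebra K R\<^esub>i\<in>{..Suc n}. arc_class K R (T i))"
      using Suc by (simp add: simps(1) Pi_def)
    finally show ?case .
  qed
qed

lemma arc_D_alg_hom:
  assumes "algebra K R"
  shows "(\<lambda>f i. arc_D K R i f) \<in> alg_hom K R (fps_algebra (arc_algebra K R))"
proof -
  interpret algebra K R by fact
  note S = arc_algebra_simps[OF assms] and W = arc_terms.intros
  note E = arc_class_eqI[of K R]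
  have one0: "arc_rel K R (Gen \<one>\<^bsub>R\<^esub> 0) (Scalar \<one>\<^bsub>K\<^esub>)"
    using gen_one[of K R 0] by simp
  have one1: "arc_rel K R (Gen \<one>\<^bsub>R\<^esub> n) (Scalar \<zero>\<^bsub>K\<^esub>)" if "0 < n" for n
    using gen_one[of K R n] that by simp
  show ?thesis
    unfolding alg_hom_def
  proof (intro CollectI conjI ballI ring_hom_memI)
    fix f g assume fg: "f \<in> carrier R" "g \<in> carrier R"
    show "(\<lambda>i. arc_D K R i (f \<otimes>\<^bsub>R\<^esub> g))
      = (\<lambda>i. arc_D K R i f) \<otimes>\<^bsub>fps_algebra (arc_algebra K R)\<^esub> (\<lambda>i. arc_D K R i g)"
    proof (rule ext)
      fix n
      have "arc_D K R n (f \<otimes>\<^bsub>R\<^esub> g)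
        = arc_class K R (arc_sum (\<lambda>i. Mul (Gen f i) (Gen g (n - i))) n)"
        unfolding arc_D_def using fg by (intro E gen_mult) (auto intro: W)
      then show "arc_D K R n (f \<otimes>\<^bsub>R\<^esub> g) = ((\<lambda>i. arc_D K R i f) \<otimes>\<^bsub>fps_algebra (arc_algebra K R)\<^esub>
          (\<lambda>i. arc_D K R i g)) n"
        using fg by (simp add: arc_class_sum[OF assms] W fps_algebra_simps S arc_D_def)
    qed
  qed (auto simp: fps_algebra_simps S W arc_D_def del: equalityI intro!: E gen_add gen_smult
        one0 one1 ext)
qed

primrec arc_eval ::
  "('k, 'a, 'm) module_scheme \<Rightarrow> ('r \<Rightarrow> nat \<Rightarrow> 'a) \<Rightarrow> ('k, 'r) arc_term \<Rightarrow> 'a" where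
  "arc_eval A h (Scalar a) = a \<odot>\<^bsub>A\<^esub> \<one>\<^bsub>A\<^esub>"
| "arc_eval A h (Gen f i) = h f i"
| "arc_eval A h (Add t u) = arc_eval A h t \<oplus>\<^bsub>A\<^esub> arc_eval A h u"
| "arc_eval A h (Mul t u) = arc_eval A h t \<otimes>\<^bsub>A\<^esub> arc_eval A h u"

theorem arc_algebra_universal:
  assumes R: "algebra K R" and A: "algebra K A" and h: "h \<in> alg_hom K R (fps_algebra A)"
  shows "\<exists>\<phi>\<in>alg_hom K (arc_algebra K R) A.
      (\<forall>f\<in>carrier R. \<forall>i. \<phi> (arc_D K R i f) = h f i) \<and>
      (\<forall>\<psi>\<in>alg_hom K (arc_algebra K R) A.
        (\<forall>f\<in>carrier R. \<forall>i. \<psi> (arc_D K R i f) = h f i) \<longrightarrow>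
        (\<forall>x\<in>carrier (arc_algebra K R). \<psi> x = \<phi> x))"
proof -
  interpret R: algebra K R by fact
  interpret A: algebra K A by fact
  note S = arc_algebra_simps[OF R] and W = arc_terms.intros
  have h_cl: "h f i \<in> carrier A" if "f \<in> carrier R" for f i
    using h that ring_hom_closed[of h R "fps_algebra A" f]
    by (simp add: alg_hom_def fps_algebra_simps)
  have h_add: "h (f \<oplus>\<^bsub>R\<^esub> g) = (\<lambda>n. h f n \<oplus>\<^bsub>A\<^esub> h g n)" if "f \<in> carrier R" "g \<in> carrier R" for f g
    using h that ring_hom_add[of h R "fps_algebra A" f g]
    by (simp add: alg_hom_def fps_algebra_simps)
  have h_mult: "h (f \<otimes>\<^bsub>R\<^esub> g) = (\<lambda>n. \<Oplus>\<^bsub>A\<^esub>i\<in>{..n}. h f i \<otimes>\<^bsub>A\<^esub> h g (n - i))"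
    if "f \<in> carrier R" "g \<in> carrier R" for f g
    using h that ring_hom_mult[of h R "fps_algebra A" f g]
    by (simp add: alg_hom_def fps_algebra_simps)
  have h_one: "h \<one>\<^bsub>R\<^esub> = (\<lambda>n. if n = 0 then \<one>\<^bsub>A\<^esub> else \<zero>\<^bsub>A\<^esub>)"
    using h ring_hom_one[of h R "fps_algebra A"] by (simp add: alg_hom_def fps_algebra_simps)
  have h_smult: "h (a \<odot>\<^bsub>R\<^esub> f) = (\<lambda>n. a \<odot>\<^bsub>A\<^esub> h f n)" if "a \<in> carrier K" "f \<in> carrier R" for a f
    using h that by (simp add: alg_hom_def fps_algebra_simps)
  let ?ev = "arc_eval A h"
  have ev_cl: "?ev t \<in> carrier A" if "t \<in> arc_terms K R" for t
    using that by induction (auto simp: h_cl)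
  have smult_eq: "(a \<odot>\<^bsub>A\<^esub> \<one>\<^bsub>A\<^esub>) \<otimes>\<^bsub>A\<^esub> x = a \<odot>\<^bsub>A\<^esub> x" if "a \<in> carrier K" "x \<in> carrier A" for a x
    using that by (simp add: A.smult_assoc2)
  have ev_sum: "?ev (arc_sum T n) = (\<Oplus>\<^bsub>A\<^esub>i\<in>{..n}. ?ev (T i))"
    if "\<And>i. i \<le> n \<Longrightarrow> T i \<in> arc_terms K R" for T n
    using that by (induction n) (auto simp: ev_cl atMost_Suc Pi_def)
  have ev_rel: "?ev t = ?ev u" if "arc_rel K R t u" for t u
    using that
  proof induction
    case (add_neg t)
    have "(\<ominus>\<^bsub>K\<^esub> \<one>\<^bsub>K\<^esub>) \<odot>\<^bsub>A\<^esub> ?ev t = \<ominus>\<^bsub>A\<^esub> (?ev t)"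
      using add_neg by (simp add: ev_cl A.smult_l_minus)
    then show ?case using add_neg by (simp add: ev_cl smult_eq A.M.l_neg)
  next
    case (scalar_mul a b)
    then show ?case by (simp add: A.smult_assoc1 smult_eq)
  next
    case (gen_mult f g n)
    then show ?case by (simp add: ev_sum W h_mult)
  qed (auto simp: ev_cl smult_eq A.M.a_assoc A.m_assoc A.l_distr A.smult_l_distr h_cl h_add
        h_one h_smult intro: A.M.a_comm A.m_comm)
  define \<phi> where "\<phi> X = ?ev (SOME t. t \<in> X)" for X
  have \<phi>: "\<phi> (arc_class K R t) = ?ev t" if "t \<in> arc_terms K R" for t
  proof -
    have "(SOME u. u \<in> arc_class K R t) \<in> arc_class K R t"
      by (rule someI[of _ t]) (simp add: arc_class_def arc_rel.refl that)
    then show ?thesis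
      unfolding \<phi>_def arc_class_def by (simp add: ev_rel)
  qed
  have "\<phi> \<in> alg_hom K (arc_algebra K R) A"
    unfolding alg_hom_def
    by (intro CollectI conjI ballI ring_hom_memI)
      (auto simp: S \<phi> W ev_cl smult_eq)
  moreover have "\<forall>f\<in>carrier R. \<forall>i. \<phi> (arc_D K R i f) = h f i"
    by (simp add: arc_D_def \<phi> W)
  moreover have "\<forall>x\<in>carrier (arc_algebra K R). \<psi> x = \<phi> x"
    if \<psi>: "\<psi> \<in> alg_hom K (arc_algebra K R) A"
      and D: "\<forall>f\<in>carrier R. \<forall>i. \<psi> (arc_D K R i f) = h f i" for \<psi>
  proof -
    have hom: "\<psi> \<in> ring_hom (arc_algebra K R) A" using \<psi> by (simp add: alg_hom_def)
    have "\<psi> (arc_class K R t) = ?ev t" if "t \<in> arc_terms K R" for t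
      using that
    proof induction
      case (Scalar a)
      have "arc_rel K R (Mul (Scalar a) (Scalar \<one>\<^bsub>K\<^esub>)) (Scalar a)"
        using Scalar by (meson W R.R.one_closed mul_comm mul_one arc_rel.trans)
      then have "arc_class K R (Scalar a) = a \<odot>\<^bsub>arc_algebra K R\<^esub> \<one>\<^bsub>arc_algebra K R\<^esub>"
        using Scalar by (auto simp: S W intro!: arc_class_eqI intro: arc_rel.sym)
      then show ?case
        using Scalar \<psi> ring_hom_one[OF hom] by (auto simp: alg_hom_def S W)
    next
      case (Gen f i)
      then show ?case using D by (simp add: arc_D_def)
    next
      case (Add t u)
      then show ?case
        using ring_hom_add[OF hom, of "arc_class K R t" "arc_class K R u"] by (simp add: S)
    next
      case (Mul t u)
      then show ?case
        using ring_hom_mult[OF hom, of "arc_class K R t" "arc_class K R u"] by (simp add: S)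
    qed
    then show ?thesis by (auto simp: S \<phi>)
  qed
  ultimately show ?thesis by blast
qed


section \<open>Local rings and the arc closure\<close>

definition local_ring :: "('a, 'm) ring_scheme \<Rightarrow> 'a set \<Rightarrow> bool" where
  "local_ring R \<mm> \<longleftrightarrow> cring R \<and> maximalideal \<mm> R \<and> (\<forall>I. maximalideal I R \<longrightarrow> I = \<mm>)"

definition arc_ideal ::
  "('k, 'z) ring_scheme \<Rightarrow> ('k, 'r, 'm) module_scheme \<Rightarrow> 'r set \<Rightarrow> ('k, 'r) arc_term set set"
  where "arc_ideal K R \<aa> = Idl\<^bsub>arc_algebra K R\<^esub> {arc_D K R i f | i f. f \<in> \<aa>}"

text \<open>The second summand is the extension of \<open>\<mm>\<close> along the structure map \<open>D 0\<close>.\<close>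

definition arc_closure ::
  "('k, 'z) ring_scheme \<Rightarrow> ('k, 'r, 'm) module_scheme \<Rightarrow> 'r set \<Rightarrow> 'r set \<Rightarrow> 'r set"
  where "arc_closure K R \<mm> \<aa> = {f \<in> carrier R.
    arc_ideal K R (PIdl\<^bsub>R\<^esub> f)
      \<subseteq> arc_ideal K R \<aa> <+>\<^bsub>arc_algebra K R\<^esub> Idl\<^bsub>arc_algebra K R\<^esub> (arc_D K R 0 ` \<mm>)}"

definition arc_closed ::
  "('k, 'z) ring_scheme \<Rightarrow> ('k, 'r, 'm) module_scheme \<Rightarrow> 'r set \<Rightarrow> 'r set \<Rightarrow> bool"
  where "arc_closed K R \<mm> \<aa> \<longleftrightarrow> \<aa> = arc_closure K R \<mm> \<aa>"

end

theory Submission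
  imports Defs
begin

text \<open>Let \<open>R = k[[y]] \<oplus> N\<close> be the square-zero extension of \<open>k[[y]]\<close> by \<open>N = k[y\<^sup>-\<^sup>1]\<close>, on which
  \<open>y\<close> acts by \<open>y \<cdot> y\<^sup>-\<^sup>n = y\<^sup>1\<^sup>-\<^sup>n\<close> and \<open>y \<cdot> 1 = 0\<close>. It is local, with \<open>y\<close> in the maximal ideal \<open>\<mm>\<close>, and
  \<open>N = yN\<close>. Writing \<open>f \<in> N\<close> as \<open>y g\<close> with \<open>g \<in> N\<close>, the Leibniz formula
  \<open>D\<^sub>n f = D\<^sub>0 y D\<^sub>n g + \<Sum>i=1..n. D\<^sub>i y D\<^sub>n\<^sub>-\<^sub>i g\<close> and induction on \<open>n\<close> show that every \<open>D\<^sub>n f\<close> lies in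
  \<open>\<mm> R\<^sub>\<infinity>\<close>, so the nonzero ideal \<open>N\<close> is contained in the arc closure of zero.\<close>

section \<open>Arcs and divisible ideals\<close>

text \<open>Each Leibniz step replaces \<open>f\<close> by its cofactor \<open>g\<close>, so the
  strong induction on \<open>i\<close> runs over all elements of \<open>N\<close> at once. In a
  local ring, a nonzero ideal \<open>N\<close> of this kind cannot be finitely generated, by
  Nakayama's lemma.\<close>

lemma arc_D_divisible:
  assumes "algebra K R" and "\<mm> \<subseteq> carrier R" and N: "N \<subseteq> carrier R"
    and div: "\<And>f. f \<in> N \<Longrightarrow> \<exists>y\<in>\<mm>. \<exists>g\<in>N. f = y \<otimes>\<^bsub>R\<^esub> g"
    and "f \<in> N"
  shows "arc_D K R i f \<in> Idl\<^bsub>arc_algebra K R\<^esub> (arc_D K R 0 ` \<mm>)"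
  using \<open>f \<in> N\<close>
proof (induction i arbitrary: f rule: less_induct)
  case (less n)
  interpret R: algebra K R by fact
  interpret S: algebra K "arc_algebra K R" by (rule arc_algebra_algebra) fact
  let ?S = "arc_algebra K R" and ?J = "Idl\<^bsub>arc_algebra K R\<^esub> (arc_D K R 0 ` \<mm>)"
  have hom: "(\<lambda>f i. arc_D K R i f) \<in> ring_hom R (fps_algebra ?S)"
    using arc_D_alg_hom[OF \<open>algebra K R\<close>] by (simp add: alg_hom_def)
  have D_closed: "arc_D K R i f \<in> carrier ?S" if "f \<in> carrier R" for f i
    using ring_hom_closed[OF hom that] by (simp add: fps_algebra_simps)
  have sub: "arc_D K R 0 ` \<mm> \<subseteq> carrier ?S"
    using D_closed \<open>\<mm> \<subseteq> carrier R\<close> by auto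
  interpret J: ideal ?J ?S by (rule S.genideal_ideal[OF sub])
  obtain y g where yg: "y \<in> \<mm>" "g \<in> N" "f = y \<otimes>\<^bsub>R\<^esub> g"
    using div less.prems by blast
  have cl: "y \<in> carrier R" "g \<in> carrier R" using yg \<open>\<mm> \<subseteq> carrier R\<close> N by auto
  have "arc_D K R n f = (\<Oplus>\<^bsub>?S\<^esub>i\<in>{..n}. arc_D K R i y \<otimes>\<^bsub>?S\<^esub> arc_D K R (n - i) g)"
    using fun_cong[OF ring_hom_mult[OF hom cl], of n] yg by (simp add: fps_algebra_simps)
  moreover have "arc_D K R i y \<otimes>\<^bsub>?S\<^esub> arc_D K R (n - i) g \<in> ?J" if "i \<le> n" for i
  proof (cases "i = 0")
    case True
    have "arc_D K R 0 y \<in> ?J" using S.genideal_self[OF sub] yg(1) by auto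
    then show ?thesis using True D_closed[OF cl(2)] by (simp add: J.I_r_closed)
  next
    case False
    then have "arc_D K R (n - i) g \<in> ?J" using that yg(2) by (intro less.IH) auto
    then show ?thesis using D_closed[OF cl(1)] by (simp add: J.I_l_closed)
  qed
  moreover have "(\<Oplus>\<^bsub>?S\<^esub>i\<in>A. h i) \<in> ?J" if "finite A" "\<And>i. i \<in> A \<Longrightarrow> h i \<in> ?J" for A :: "nat set" and h
    using that
  proof (induction A rule: finite_induct)
    case (insert a A)
    then show ?case
      by (subst S.M.finsum_insert) (auto intro: J.a_closed J.a_Hcarr)
  qed (simp add: J.zero_closed)
  ultimately show ?case by (metis (no_types, lifting) atMost_iff finite_atMost)
qed

text \<open>As \<open>N\<close> is an ideal, it contains all multiples of \<open>f\<close>, so every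
  generator of their arc ideal lies in the extension of \<mm>. That summand alone bounds the arc
  ideal, whatever \<aa> contributes.\<close>

lemma divisible_subset_arc_closure:
  assumes "algebra K R" and "\<mm> \<subseteq> carrier R" and N: "ideal N R"
    and "\<And>f. f \<in> N \<Longrightarrow> \<exists>y\<in>\<mm>. \<exists>g\<in>N. f = y \<otimes>\<^bsub>R\<^esub> g"
    and "\<aa> \<subseteq> carrier R"
  shows "N \<subseteq> arc_closure K R \<mm> \<aa>"
proof
  fix f assume f: "f \<in> N"
  interpret R: algebra K R by fact
  interpret S: algebra K "arc_algebra K R" by (rule arc_algebra_algebra) fact
  interpret N: ideal N R by fact
  let ?S = "arc_algebra K R" and ?J = "Idl\<^bsub>arc_algebra K R\<^esub> (arc_D K R 0 ` \<mm>)"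
  have D_closed: "arc_D K R i g \<in> carrier ?S" if "g \<in> carrier R" for g i
    using that by (simp add: arc_D_def arc_algebra_simps[OF \<open>algebra K R\<close>] arc_terms.Gen)
  have J: "ideal ?J ?S"
    using \<open>\<mm> \<subseteq> carrier R\<close> by (intro S.genideal_ideal) (auto intro: D_closed)
  have A: "ideal (arc_ideal K R \<aa>) ?S"
    unfolding arc_ideal_def using \<open>\<aa> \<subseteq> carrier R\<close>
    by (intro S.genideal_ideal) (auto intro: D_closed)
  have "PIdl\<^bsub>R\<^esub> f \<subseteq> N"
    using f N by (intro R.cgenideal_minimal)
  then have "arc_ideal K R (PIdl\<^bsub>R\<^esub> f) \<subseteq> ?J"
    unfolding arc_ideal_def using assms N.a_subset
    by (intro S.genideal_minimal[OF J]) (auto intro!: arc_D_divisible[where N = N])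
  also have "?J \<subseteq> arc_ideal K R \<aa> <+>\<^bsub>?S\<^esub> ?J"
  proof
    fix x assume x: "x \<in> ?J"
    then have "x = \<zero>\<^bsub>?S\<^esub> \<oplus>\<^bsub>?S\<^esub> x" using ideal.Icarr[OF J] by simp
    then show "x \<in> arc_ideal K R \<aa> <+>\<^bsub>?S\<^esub> ?J"
      using x additive_subgroup.zero_closed[OF ideal.axioms(1)[OF A]]
      unfolding set_add_def' by blast
  qed
  finally show "f \<in> arc_closure K R \<mm> \<aa>"
    using f N.a_subset by (auto simp: arc_closure_def)
qed

section \<open>Recognizing a local ring by its nonunits\<close>

lemma local_ringI:
  assumes "cring R" and \<mm>: "ideal \<mm> R" and "\<one>\<^bsub>R\<^esub> \<notin> \<mm>"
    and units: "\<And>x. x \<in> carrier R \<Longrightarrow> x \<notin> \<mm> \<Longrightarrow> \<exists>y\<in>carrier R. y \<otimes>\<^bsub>R\<^esub> x = \<one>\<^bsub>R\<^esub>"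
  shows "local_ring R \<mm>"
proof -
  interpret cring R by fact
  \<comment> \<open>An ideal with an element \<open>x\<close> outside \<mm> contains
    \<open>y x = 1\<close>. Hence \<mm> contains every proper ideal, which gives both maximality and
    uniqueness.\<close>
  have proper: "J \<subseteq> \<mm>" if J: "ideal J R" "J \<noteq> carrier R" for J
  proof
    fix x assume x: "x \<in> J"
    show "x \<in> \<mm>"
    proof (rule ccontr)
      assume "x \<notin> \<mm>"
      then obtain y where "y \<in> carrier R" "y \<otimes>\<^bsub>R\<^esub> x = \<one>\<^bsub>R\<^esub>"
        using units x ideal.Icarr[OF J(1)] by blast
      then have "\<one>\<^bsub>R\<^esub> \<in> J" using ideal.I_l_closed[OF J(1) x] by metis
      then show False using ideal.one_imp_carrier J by blast
    qed
  qed
  have ne: "carrier R \<noteq> \<mm>" using assms(3) one_closed by blast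
  have "maximalideal \<mm> R"
    using proper ne by (intro maximalidealI \<mm>) blast+
  moreover have "I = \<mm>" if "maximalideal I R" for I
  proof -
    interpret I: maximalideal I R by fact
    show ?thesis
      using I.I_maximal[OF \<mm> proper] I.I_notcarr I.ideal_axioms ne ideal.Icarr[OF \<mm>] by blast
  qed
  ultimately show ?thesis using \<open>cring R\<close> unfolding local_ring_def by blast
qed

section \<open>Power series acting on inverse polynomials\<close>

text \<open>Over a field \<open>A\<close>, this is the injective hull of the residue field of
  \<open>A[[y]]\<close>: every element is killed by a power of \<open>y\<close>, yet multiplication
  by \<open>y\<close> is surjective.\<close>

definition inverse_polys :: "('a, 'm) ring_scheme \<Rightarrow> (nat \<Rightarrow> 'a) set" where
  "inverse_polys A = {v. (\<forall>n. v n \<in> carrier A) \<and> (\<exists>d. \<forall>n>d. v n = \<zero>\<^bsub>A\<^esub>)}"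

text \<open>Macaulay's contraction action of \<open>A[[y]]\<close> on \<open>A[y\<^sup>-\<^sup>1]\<close>: here \<open>v\<close> stands for
  \<open>\<Sum>n. v n y\<^sup>-\<^sup>n\<close>, and positive powers of \<open>y\<close> in the product are dropped.\<close>

definition contract :: "('a, 'm) ring_scheme \<Rightarrow> (nat \<Rightarrow> 'a) \<Rightarrow> (nat \<Rightarrow> 'a) \<Rightarrow> nat \<Rightarrow> 'a" where
  "contract A a v n = (\<Oplus>\<^bsub>A\<^esub>i\<in>{i. v (n + i) \<noteq> \<zero>\<^bsub>A\<^esub>}. a i \<otimes>\<^bsub>A\<^esub> v (n + i))"

text \<open>If \<open>v\<close> vanishes beyond \<open>d\<close>, this is the power series
  \<open>y^d v\<close>: multiplying by \<open>y^d\<close> clears the negative exponents and reverses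
  the coefficients.\<close>

definition flip :: "('a, 'm) ring_scheme \<Rightarrow> nat \<Rightarrow> (nat \<Rightarrow> 'a) \<Rightarrow> nat \<Rightarrow> 'a" where
  "flip A d v = (\<lambda>j. if j \<le> d then v (d - j) else \<zero>\<^bsub>A\<^esub>)"

context algebra
begin

interpretation P: algebra R "fps_algebra M"
  by (rule fps_algebra_algebra) (rule algebra_axioms)

lemma fps_mult_cong:
  assumes "\<And>i. i \<le> n \<Longrightarrow> G i = G' i" "F \<in> carrier (fps_algebra M)" "G' \<in> carrier (fps_algebra M)"
  shows "(F \<otimes>\<^bsub>fps_algebra M\<^esub> G) n = (F \<otimes>\<^bsub>fps_algebra M\<^esub> G') n"
  using assms by (auto simp: fps_algebra_simps intro!: M.finsum_cong')

text \<open>The coefficients of the inverse are found recursively: in degree \<open>n\<close> the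
  equation fixes \<open>a 0\<close> times the new coefficient in terms of the earlier ones, and
  \<open>c\<close> inverts \<open>a 0\<close>.\<close>

lemma fps_unit:
  assumes "a \<in> carrier (fps_algebra M)" "c \<in> carrier M" "c \<otimes>\<^bsub>M\<^esub> a 0 = \<one>\<^bsub>M\<^esub>"
  shows "\<exists>b\<in>carrier (fps_algebra M). a \<otimes>\<^bsub>fps_algebra M\<^esub> b = \<one>\<^bsub>fps_algebra M\<^esub>"
proof -
  note a = assms(1)[unfolded fps_algebra_simps]
  \<comment> \<open>The candidate \<open>r\<close> stands in for \<open>b n\<close>, so that
    \<open>?P b n r\<close> depends on \<open>b\<close> below \<open>n\<close> only, as the choice
    principle demands. The guard \<open>n < i\<close> covers indices outside the sum, where
    truncated subtraction would otherwise read \<open>b 0\<close> even for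
    \<open>n = 0\<close>.\<close>
  let ?P = "\<lambda>b n r. r \<in> carrier M \<and>
    (\<Oplus>\<^bsub>M\<^esub>i\<in>{..n}. a i \<otimes>\<^bsub>M\<^esub> (if i = 0 \<or> n < i then r else b (n - i))) = \<one>\<^bsub>fps_algebra M\<^esub> n"
  have "\<exists>b. \<forall>n. ?P b n (b n)"
  proof (rule dependent_wellorder_choice)
    fix r :: 'c and f g :: "nat \<Rightarrow> 'c" and n :: nat
    assume "\<And>y. y < n \<Longrightarrow> f y = g y"
    then have "(if i = 0 \<or> n < i then r else f (n - i)) = (if i = 0 \<or> n < i then r else g (n - i))" for i
      by auto
    then show "?P f n r = ?P g n r" by presburger
  next
    fix n :: nat and b
    assume IH: "\<And>y. y < n \<Longrightarrow> ?P b y (b y)"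
    define s where "s = (\<Oplus>\<^bsub>M\<^esub>i\<in>{1..n}. a i \<otimes>\<^bsub>M\<^esub> b (n - i))"
    have s: "s \<in> carrier M"
      unfolding s_def using a IH by (intro M.finsum_closed) auto
    define e where "e = \<one>\<^bsub>fps_algebra M\<^esub> n"
    have e: "e \<in> carrier M" by (simp add: e_def fps_algebra_simps)
    \<comment> \<open>The degree \<open>n\<close> equation is \<open>a 0 r + s = e\<close>, with
      \<open>s\<close> collecting the earlier coefficients.\<close>
    define r where "r = c \<otimes>\<^bsub>M\<^esub> (e \<ominus>\<^bsub>M\<^esub> s)"
    have r: "r \<in> carrier M" using s e assms by (simp add: r_def)
    have "(\<Oplus>\<^bsub>M\<^esub>i\<in>{..n}. a i \<otimes>\<^bsub>M\<^esub> (if i = 0 \<or> n < i then r else b (n - i)))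
       = (\<Oplus>\<^bsub>M\<^esub>i\<in>insert 0 {1..n}. a i \<otimes>\<^bsub>M\<^esub> (if i = 0 \<or> n < i then r else b (n - i)))"
      by (rule arg_cong[where f = "finsum M _"]) auto
    also have "\<dots> = a 0 \<otimes>\<^bsub>M\<^esub> r \<oplus>\<^bsub>M\<^esub> (\<Oplus>\<^bsub>M\<^esub>i\<in>{1..n}. a i \<otimes>\<^bsub>M\<^esub> (if i = 0 \<or> n < i then r else b (n - i)))"
      using a r IH by (subst M.finsum_insert) auto
    also have "(\<Oplus>\<^bsub>M\<^esub>i\<in>{1..n}. a i \<otimes>\<^bsub>M\<^esub> (if i = 0 \<or> n < i then r else b (n - i))) = s"
      unfolding s_def using a IH by (intro M.finsum_cong') auto
    also have "a 0 \<otimes>\<^bsub>M\<^esub> r = c \<otimes>\<^bsub>M\<^esub> a 0 \<otimes>\<^bsub>M\<^esub> (e \<ominus>\<^bsub>M\<^esub> s)"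
      unfolding r_def using a e s assms by (simp add: m_ac(1)[symmetric] m_comm)
    also have "\<dots> \<oplus>\<^bsub>M\<^esub> s = e"
      using s e assms by (simp add: M.minus_eq M.a_assoc M.l_neg)
    finally show "\<exists>r. ?P b n r" using r e_def by blast
  qed
  then obtain b where b: "\<And>n. ?P b n (b n)" by blast
  have "a \<otimes>\<^bsub>fps_algebra M\<^esub> b = \<one>\<^bsub>fps_algebra M\<^esub>"
  proof
    fix n
    have "(a \<otimes>\<^bsub>fps_algebra M\<^esub> b) n = (\<Oplus>\<^bsub>M\<^esub>i\<in>{..n}. a i \<otimes>\<^bsub>M\<^esub> (if i = 0 \<or> n < i then b n else b (n - i)))"
      unfolding fps_algebra_simps using a b by (intro M.finsum_cong') auto
    then show "(a \<otimes>\<^bsub>fps_algebra M\<^esub> b) n = \<one>\<^bsub>fps_algebra M\<^esub> n" using b[of n] by simp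
  qed
  then show ?thesis using b by (auto simp: fps_algebra_simps)
qed

section \<open>Module laws for the contraction action\<close>

lemma inverse_polysE:
  assumes "v \<in> inverse_polys M" "w \<in> inverse_polys M"
  obtains d where "\<And>n. n > d \<Longrightarrow> v n = \<zero>\<^bsub>M\<^esub>" "\<And>n. n > d \<Longrightarrow> w n = \<zero>\<^bsub>M\<^esub>"
proof -
  obtain d e where "\<And>n. n > d \<Longrightarrow> v n = \<zero>\<^bsub>M\<^esub>" "\<And>n. n > e \<Longrightarrow> w n = \<zero>\<^bsub>M\<^esub>"
    using assms unfolding inverse_polys_def by blast
  then show ?thesis using that[of "max d e"] by simp
qed

lemma flip_closed: "v \<in> inverse_polys M \<Longrightarrow> flip M d v \<in> carrier (fps_algebra M)"
  by (auto simp: flip_def fps_algebra_simps inverse_polys_def)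

text \<open>The coefficient of \<open>y^-n\<close> in \<open>a v\<close> is that of
  \<open>y^(d-n)\<close> in \<open>a (y^d v)\<close>; the positive powers dropped by
  \<open>contract\<close> sit in degrees above \<open>d\<close>. Enlarging the index set to
  \<open>{..d - n}\<close> adds only zero terms.\<close>

lemma contract_eq_flip:
  assumes "a \<in> carrier (fps_algebra M)" "v \<in> inverse_polys M" "\<And>n. n > d \<Longrightarrow> v n = \<zero>\<^bsub>M\<^esub>" "n \<le> d"
  shows "contract M a v n = (a \<otimes>\<^bsub>fps_algebra M\<^esub> flip M d v) (d - n)"
proof -
  have fl: "flip M d v (d - n - i) = v (n + i)" if "i \<le> d - n" for i
  proof -
    have "d - (d - n - i) = n + i" using that \<open>n \<le> d\<close> by linarith
    then show ?thesis by (simp add: flip_def)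
  qed
  have "contract M a v n = (\<Oplus>\<^bsub>M\<^esub>i\<in>{..d - n}. a i \<otimes>\<^bsub>M\<^esub> flip M d v (d - n - i))"
    unfolding contract_def
  proof (rule M.add.finprod_mono_neutral_cong_left)
    show sub: "{i. v (n + i) \<noteq> \<zero>\<^bsub>M\<^esub>} \<subseteq> {..d - n}"
    proof
      fix i assume "i \<in> {i. v (n + i) \<noteq> \<zero>\<^bsub>M\<^esub>}"
      then have "\<not> d < n + i" using assms(3) by auto
      then show "i \<in> {..d - n}" by simp
    qed
    show "a i \<otimes>\<^bsub>M\<^esub> v (n + i) = a i \<otimes>\<^bsub>M\<^esub> flip M d v (d - n - i)"
      if "i \<in> {i. v (n + i) \<noteq> \<zero>\<^bsub>M\<^esub>}" for i
      using fl sub that by auto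
    show "a i \<otimes>\<^bsub>M\<^esub> flip M d v (d - n - i) = \<zero>\<^bsub>M\<^esub>"
      if "i \<in> {..d - n} - {i. v (n + i) \<noteq> \<zero>\<^bsub>M\<^esub>}" for i
      using fl[of i] that assms(1) by (simp add: fps_algebra_simps)
  qed (use assms(1,2) in \<open>auto simp: inverse_polys_def fps_algebra_simps flip_def\<close>)
  then show ?thesis by (simp add: fps_algebra_simps)
qed

lemma contract_above:
  assumes "\<And>n. n > d \<Longrightarrow> v n = \<zero>\<^bsub>M\<^esub>" "n > d"
  shows "contract M a v n = \<zero>\<^bsub>M\<^esub>"
  using assms by (simp add: contract_def)

lemma contract_closed:
  assumes "a \<in> carrier (fps_algebra M)" "v \<in> inverse_polys M"
  shows "contract M a v \<in> inverse_polys M"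
proof -
  obtain d where d: "\<And>n. n > d \<Longrightarrow> v n = \<zero>\<^bsub>M\<^esub>" using inverse_polysE[OF assms(2,2)] by blast
  have "contract M a v n \<in> carrier M" for n
    unfolding contract_def using assms
    by (intro M.finsum_closed) (auto simp: fps_algebra_simps inverse_polys_def)
  moreover have "contract M a v n = \<zero>\<^bsub>M\<^esub>" if "n > d" for n
    by (rule contract_above[OF d that])
  ultimately show ?thesis by (auto simp: inverse_polys_def)
qed

text \<open>The module laws below are transferred from the ring of power series in this way, by
  comparing coefficients up to a common degree bound.\<close>

lemma contract_eqI:
  assumes "a \<in> carrier (fps_algebra M)" "v \<in> inverse_polys M"
    and d: "\<And>n. n > d \<Longrightarrow> v n = \<zero>\<^bsub>M\<^esub>" "\<And>n. n > d \<Longrightarrow> w n = \<zero>\<^bsub>M\<^esub>"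
    and "\<And>n. n \<le> d \<Longrightarrow> (a \<otimes>\<^bsub>fps_algebra M\<^esub> flip M d v) (d - n) = w n"
  shows "contract M a v = w"
proof
  fix n show "contract M a v n = w n"
    using assms contract_eq_flip[of a v d n] contract_above[of d v n a] by (cases "n \<le> d") auto
qed

lemma contract_assoc:
  assumes a: "a \<in> carrier (fps_algebra M)" and b: "b \<in> carrier (fps_algebra M)"
    and v: "v \<in> inverse_polys M"
  shows "contract M (a \<otimes>\<^bsub>fps_algebra M\<^esub> b) v = contract M a (contract M b v)"
proof -
  obtain d where d: "\<And>n. n > d \<Longrightarrow> v n = \<zero>\<^bsub>M\<^esub>" using inverse_polysE[OF v v] by blast
  note bv = contract_closed[OF b v] contract_above[OF d]
  show ?thesis
  proof (rule contract_eqI[OF _ v d])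
    show "contract M a (contract M b v) n = \<zero>\<^bsub>M\<^esub>" if "n > d" for n
      by (rule contract_above[OF bv(2) that])
    fix n assume n: "n \<le> d"
    have "contract M a (contract M b v) n
      = (a \<otimes>\<^bsub>fps_algebra M\<^esub> flip M d (contract M b v)) (d - n)"
      by (rule contract_eq_flip[OF a bv n])
    \<comment> \<open>\<open>flip\<close> truncates above degree \<open>d\<close>, so the two
      right-hand factors agree only up to \<open>d\<close>. This suffices, because only the
      coefficient at \<open>d - n\<close> is read.\<close>
    also have "\<dots> = (a \<otimes>\<^bsub>fps_algebra M\<^esub> (b \<otimes>\<^bsub>fps_algebra M\<^esub> flip M d v)) (d - n)"
      using contract_eq_flip[OF b v d] n
      by (intro fps_mult_cong a P.m_closed b flip_closed v) (auto simp: flip_def[of _ _ "contract M b v"])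
    finally show "((a \<otimes>\<^bsub>fps_algebra M\<^esub> b) \<otimes>\<^bsub>fps_algebra M\<^esub> flip M d v) (d - n)
      = contract M a (contract M b v) n"
      by (simp add: P.m_assoc a b flip_closed v)
  qed (simp add: a b)
qed

lemma contract_one: "v \<in> inverse_polys M \<Longrightarrow> contract M \<one>\<^bsub>fps_algebra M\<^esub> v = v"
proof -
  assume v: "v \<in> inverse_polys M"
  obtain d where d: "\<And>n. n > d \<Longrightarrow> v n = \<zero>\<^bsub>M\<^esub>" using inverse_polysE[OF v v] by blast
  show ?thesis
    by (rule contract_eqI[OF P.one_closed v d d]) (simp_all add: flip_closed v, simp add: flip_def)
qed

lemma contract_add_left:
  assumes a: "a \<in> carrier (fps_algebra M)" and b: "b \<in> carrier (fps_algebra M)"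
    and v: "v \<in> inverse_polys M"
  shows "contract M (a \<oplus>\<^bsub>fps_algebra M\<^esub> b) v = (\<lambda>n. contract M a v n \<oplus>\<^bsub>M\<^esub> contract M b v n)"
proof -
  obtain d where d: "\<And>n. n > d \<Longrightarrow> v n = \<zero>\<^bsub>M\<^esub>" using inverse_polysE[OF v v] by blast
  show ?thesis
  proof (rule contract_eqI[OF _ v d])
    fix n assume "n \<le> d"
    then show "((a \<oplus>\<^bsub>fps_algebra M\<^esub> b) \<otimes>\<^bsub>fps_algebra M\<^esub> flip M d v) (d - n)
      = contract M a v n \<oplus>\<^bsub>M\<^esub> contract M b v n"
      using a b v by (simp add: contract_eq_flip[OF a v d] contract_eq_flip[OF b v d]
          P.l_distr flip_closed) (simp add: fps_algebra_simps(5))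
  qed (simp_all add: contract_above[OF d] a b)
qed

lemma contract_add_right:
  assumes a: "a \<in> carrier (fps_algebra M)"
    and v: "v \<in> inverse_polys M" and w: "w \<in> inverse_polys M"
  shows "contract M a (\<lambda>n. v n \<oplus>\<^bsub>M\<^esub> w n) = (\<lambda>n. contract M a v n \<oplus>\<^bsub>M\<^esub> contract M a w n)"
proof -
  \<comment> \<open>A common bound lets the same \<open>flip M d\<close> apply to \<open>v\<close>,
    \<open>w\<close> and their sum.\<close>
  obtain d where d: "\<And>n. n > d \<Longrightarrow> v n = \<zero>\<^bsub>M\<^esub>" "\<And>n. n > d \<Longrightarrow> w n = \<zero>\<^bsub>M\<^esub>"
    using inverse_polysE[OF v w] by blast
  have vw: "(\<lambda>n. v n \<oplus>\<^bsub>M\<^esub> w n) \<in> inverse_polys M"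
    using d v w by (auto simp: inverse_polys_def intro!: exI[of _ d])
  have fl: "flip M d (\<lambda>n. v n \<oplus>\<^bsub>M\<^esub> w n) = flip M d v \<oplus>\<^bsub>fps_algebra M\<^esub> flip M d w"
    by (auto simp: flip_def fps_algebra_simps)
  show ?thesis
  proof (rule contract_eqI[OF a vw, of d])
    fix n assume "n \<le> d"
    then show "(a \<otimes>\<^bsub>fps_algebra M\<^esub> flip M d (\<lambda>n. v n \<oplus>\<^bsub>M\<^esub> w n)) (d - n)
      = contract M a v n \<oplus>\<^bsub>M\<^esub> contract M a w n"
      using a v w by (simp add: contract_eq_flip[OF a v d(1)] contract_eq_flip[OF a w d(2)]
          P.r_distr flip_closed fl) (simp add: fps_algebra_simps(5))
  qed (simp_all add: contract_above[OF d(1)] contract_above[OF d(2)] d)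
qed

lemma contract_smult_left:
  assumes c: "c \<in> carrier R" and a: "a \<in> carrier (fps_algebra M)" and v: "v \<in> inverse_polys M"
  shows "contract M (c \<odot>\<^bsub>fps_algebra M\<^esub> a) v = (\<lambda>n. c \<odot>\<^bsub>M\<^esub> contract M a v n)"
proof -
  obtain d where d: "\<And>n. n > d \<Longrightarrow> v n = \<zero>\<^bsub>M\<^esub>" using inverse_polysE[OF v v] by blast
  show ?thesis
  proof (rule contract_eqI[OF _ v d])
    fix n assume "n \<le> d"
    then show "((c \<odot>\<^bsub>fps_algebra M\<^esub> a) \<otimes>\<^bsub>fps_algebra M\<^esub> flip M d v) (d - n)
      = c \<odot>\<^bsub>M\<^esub> contract M a v n"
      using a v c by (simp add: contract_eq_flip[OF a v d] P.smult_assoc2 flip_closed)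
        (simp add: fps_algebra_simps(6))
  qed (simp_all add: contract_above[OF d] a c)
qed

lemma contract_smult_right:
  assumes c: "c \<in> carrier R" and a: "a \<in> carrier (fps_algebra M)" and v: "v \<in> inverse_polys M"
  shows "contract M a (\<lambda>n. c \<odot>\<^bsub>M\<^esub> v n) = (\<lambda>n. c \<odot>\<^bsub>M\<^esub> contract M a v n)"
proof -
  obtain d where d: "\<And>n. n > d \<Longrightarrow> v n = \<zero>\<^bsub>M\<^esub>" using inverse_polysE[OF v v] by blast
  have cv: "(\<lambda>n. c \<odot>\<^bsub>M\<^esub> v n) \<in> inverse_polys M"
    using d v c by (auto simp: inverse_polys_def intro!: exI[of _ d])
  have fl: "flip M d (\<lambda>n. c \<odot>\<^bsub>M\<^esub> v n) = c \<odot>\<^bsub>fps_algebra M\<^esub> flip M d v"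
    using c by (auto simp: flip_def fps_algebra_simps)
  have eq: "a \<otimes>\<^bsub>fps_algebra M\<^esub> (c \<odot>\<^bsub>fps_algebra M\<^esub> flip M d v)
     = c \<odot>\<^bsub>fps_algebra M\<^esub> (a \<otimes>\<^bsub>fps_algebra M\<^esub> flip M d v)"
    using a c v by (simp add: P.m_comm[of a] P.smult_assoc2 flip_closed)
  show ?thesis
  proof (rule contract_eqI[OF a cv, of d])
    fix n assume "n \<le> d"
    then show "(a \<otimes>\<^bsub>fps_algebra M\<^esub> flip M d (\<lambda>n. c \<odot>\<^bsub>M\<^esub> v n)) (d - n)
      = c \<odot>\<^bsub>M\<^esub> contract M a v n"
      by (simp add: contract_eq_flip[OF a v d] fl eq) (simp add: fps_algebra_simps(6))
  qed (simp_all add: contract_above[OF d] d c)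
qed

end

section \<open>The square-zero extension of power series by inverse polynomials\<close>

text \<open>A pair \<open>(a, v)\<close> of a power series and an inverse polynomial is stored in a single sequence,
  \<open>a\<close> at the even positions and \<open>v\<close> at the odd ones.\<close>

definition evens :: "(nat \<Rightarrow> 'a) \<Rightarrow> nat \<Rightarrow> 'a" where "evens F = (\<lambda>n. F (2 * n))"

definition odds :: "(nat \<Rightarrow> 'a) \<Rightarrow> nat \<Rightarrow> 'a" where "odds F = (\<lambda>n. F (2 * n + 1))"

definition interleave :: "(nat \<Rightarrow> 'a) \<Rightarrow> (nat \<Rightarrow> 'a) \<Rightarrow> nat \<Rightarrow> 'a" where
  "interleave a v = (\<lambda>n. if even n then a (n div 2) else v (n div 2))"

lemma evens_interleave [simp]: "evens (interleave a v) = a"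
  and odds_interleave [simp]: "odds (interleave a v) = v"
  by (simp_all add: evens_def odds_def interleave_def)

lemma evens_odds_eqI: "evens F = evens G \<Longrightarrow> odds F = odds G \<Longrightarrow> F = G"
proof
  fix n assume "evens F = evens G" "odds F = odds G"
  then show "F n = G n"
    unfolding evens_def odds_def fun_eq_iff by (cases "even n") (auto elim!: evenE oddE)
qed

text \<open>This is Nagata's idealization, with product
  \<open>(a, v) (b, w) = (a b, a w + b v)\<close>. Interleaving keeps its elements in a type of
  sequences and leaves addition and scalar multiplication pointwise.\<close>

definition fps_square_zero :: "('k, 'a, 'm) module_scheme \<Rightarrow> ('k, nat \<Rightarrow> 'a) module" where
  "fps_square_zero A = \<lparr>
     carrier = {F. evens F \<in> carrier (fps_algebra A) \<and> odds F \<in> inverse_polys A},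
     monoid.mult = (\<lambda>F G. interleave (evens F \<otimes>\<^bsub>fps_algebra A\<^esub> evens G)
       (\<lambda>n. contract A (evens F) (odds G) n \<oplus>\<^bsub>A\<^esub> contract A (evens G) (odds F) n)),
     one = interleave \<one>\<^bsub>fps_algebra A\<^esub> (\<lambda>n. \<zero>\<^bsub>A\<^esub>),
     zero = (\<lambda>n. \<zero>\<^bsub>A\<^esub>),
     add = (\<lambda>F G n. F n \<oplus>\<^bsub>A\<^esub> G n),
     smult = (\<lambda>a F n. a \<odot>\<^bsub>A\<^esub> F n)\<rparr>"

lemma fps_square_zero_simps:
  "F \<in> carrier (fps_square_zero A) \<longleftrightarrow> evens F \<in> carrier (fps_algebra A) \<and> odds F \<in> inverse_polys A"
  "evens (F \<otimes>\<^bsub>fps_square_zero A\<^esub> G) = evens F \<otimes>\<^bsub>fps_algebra A\<^esub> evens G"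
  "odds (F \<otimes>\<^bsub>fps_square_zero A\<^esub> G)
    = (\<lambda>n. contract A (evens F) (odds G) n \<oplus>\<^bsub>A\<^esub> contract A (evens G) (odds F) n)"
  "evens \<one>\<^bsub>fps_square_zero A\<^esub> = \<one>\<^bsub>fps_algebra A\<^esub>"
  "odds \<one>\<^bsub>fps_square_zero A\<^esub> = (\<lambda>n. \<zero>\<^bsub>A\<^esub>)"
  "evens \<zero>\<^bsub>fps_square_zero A\<^esub> = \<zero>\<^bsub>fps_algebra A\<^esub>"
  "odds \<zero>\<^bsub>fps_square_zero A\<^esub> = (\<lambda>n. \<zero>\<^bsub>A\<^esub>)"
  "evens (F \<oplus>\<^bsub>fps_square_zero A\<^esub> G) = evens F \<oplus>\<^bsub>fps_algebra A\<^esub> evens G"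
  "odds (F \<oplus>\<^bsub>fps_square_zero A\<^esub> G) = (\<lambda>n. odds F n \<oplus>\<^bsub>A\<^esub> odds G n)"
  "evens (a \<odot>\<^bsub>fps_square_zero A\<^esub> F) = a \<odot>\<^bsub>fps_algebra A\<^esub> evens F"
  "odds (a \<odot>\<^bsub>fps_square_zero A\<^esub> F) = (\<lambda>n. a \<odot>\<^bsub>A\<^esub> odds F n)"
  by (simp_all add: fps_square_zero_def fps_algebra_simps(3-6))
    (simp_all add: evens_def odds_def)

context algebra
begin

interpretation P: algebra R "fps_algebra M"
  by (rule fps_algebra_algebra) (rule algebra_axioms)

lemma inverse_polys_nth: "v \<in> inverse_polys M \<Longrightarrow> v n \<in> carrier M"
  by (simp add: inverse_polys_def)

lemma inverse_polys_zero: "(\<lambda>n. \<zero>\<^bsub>M\<^esub>) \<in> inverse_polys M"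
  by (simp add: inverse_polys_def)

lemma inverse_polys_add:
  assumes "v \<in> inverse_polys M" "w \<in> inverse_polys M"
  shows "(\<lambda>n. v n \<oplus>\<^bsub>M\<^esub> w n) \<in> inverse_polys M"
proof -
  obtain d where "\<And>n. n > d \<Longrightarrow> v n = \<zero>\<^bsub>M\<^esub>" "\<And>n. n > d \<Longrightarrow> w n = \<zero>\<^bsub>M\<^esub>"
    using inverse_polysE[OF assms] by blast
  then show ?thesis using assms by (auto simp: inverse_polys_def intro!: exI[of _ d])
qed

lemma inverse_polys_smult:
  "c \<in> carrier R \<Longrightarrow> v \<in> inverse_polys M \<Longrightarrow> (\<lambda>n. c \<odot>\<^bsub>M\<^esub> v n) \<in> inverse_polys M"
  by (force simp: inverse_polys_def)

lemma contract_zero_right: "contract M a (\<lambda>n. \<zero>\<^bsub>M\<^esub>) = (\<lambda>n. \<zero>\<^bsub>M\<^esub>)"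
  unfolding contract_def by (simp add: fun_eq_iff)

text \<open>Each axiom splits by \<open>evens_odds_eqI\<close> into an algebra law for power series
  and a module law for \<open>contract\<close>.\<close>

lemma fps_square_zero_algebra: "algebra R (fps_square_zero M)"
proof -
  let ?E = "fps_square_zero M"
  note S = fps_square_zero_simps
  note cl = inverse_polys_nth[of "odds F" for F] inverse_polys_zero inverse_polys_add inverse_polys_smult
    contract_closed inverse_polys_nth[OF contract_closed]
  have ag: "abelian_group ?E"
  proof (rule abelian_groupI)
    fix F assume F: "F \<in> carrier ?E"
    \<comment> \<open>The negative is formed by scalar multiplication with -1, whose even and odd
      parts are known.\<close>
    let ?G = "(\<ominus>\<^bsub>R\<^esub> \<one>\<^bsub>R\<^esub>) \<odot>\<^bsub>?E\<^esub> F"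
    show "\<exists>G\<in>carrier ?E. G \<oplus>\<^bsub>?E\<^esub> F = \<zero>\<^bsub>?E\<^esub>"
    proof (rule bexI[of _ ?G])
      show "?G \<in> carrier ?E" using F by (simp add: S cl)
      show "?G \<oplus>\<^bsub>?E\<^esub> F = \<zero>\<^bsub>?E\<^esub>"
        by (rule evens_odds_eqI; insert F)
          (simp_all add: S cl P.smult_l_minus smult_l_minus P.M.l_neg M.l_neg)
    qed
  qed ((rule evens_odds_eqI)?; simp add: S cl P.M.a_ac M.a_ac)+
  have cm: "comm_monoid ?E"
    by (rule comm_monoidI; (rule evens_odds_eqI)?)
      (simp_all add: S cl P.m_ac M.a_ac contract_one contract_zero_right
        contract_add_right contract_assoc[symmetric])
  have cr: "cring ?E"
    by (rule cringI[OF ag cm], rule evens_odds_eqI)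
      (simp_all add: S cl P.l_distr contract_add_left contract_add_right M.a_ac)
  show ?thesis
    by (rule algebraI[OF R.cring_axioms cr]; (rule evens_odds_eqI)?)
      (simp_all add: S cl P.smult_l_distr P.smult_r_distr smult_l_distr smult_r_distr
        P.smult_assoc1 smult_assoc1 P.smult_assoc2 contract_smult_left contract_smult_right)
qed

text \<open>The inverse polynomials square to zero, so a pair is invertible as soon as its power
  series is, and for that an invertible constant coefficient suffices.\<close>

lemma fps_square_zero_local_ring:
  assumes "\<one>\<^bsub>M\<^esub> \<noteq> \<zero>\<^bsub>M\<^esub>"
    and units: "\<And>x. x \<in> carrier M \<Longrightarrow> x \<noteq> \<zero>\<^bsub>M\<^esub> \<Longrightarrow> \<exists>y\<in>carrier M. y \<otimes>\<^bsub>M\<^esub> x = \<one>\<^bsub>M\<^esub>"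
  shows "local_ring (fps_square_zero M) {F \<in> carrier (fps_square_zero M). evens F 0 = \<zero>\<^bsub>M\<^esub>}"
    (is "local_ring ?E ?m")
proof -
  interpret E: algebra R ?E by (rule fps_square_zero_algebra)
  note S = fps_square_zero_simps
  have mult0: "evens (F \<otimes>\<^bsub>?E\<^esub> G) 0 = evens F 0 \<otimes>\<^bsub>M\<^esub> evens G 0"
    if "F \<in> carrier ?E" "G \<in> carrier ?E" for F G
    using that by (simp add: S fps_algebra_simps)
  have ev0: "evens F 0 \<in> carrier M" if "F \<in> carrier ?E" for F
    using that by (simp add: S fps_algebra_simps)
  show ?thesis
  proof (rule local_ringI)
    show "ideal ?m ?E"
    proof (rule idealI)
      show "subgroup ?m (add_monoid ?E)"
      proof (rule E.M.add.subgroupI)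
        show "?m \<noteq> {}"
          using E.M.zero_closed by (auto simp: S(6) fps_algebra_simps(4) intro!: exI[of _ "\<zero>\<^bsub>?E\<^esub>"])
        fix F assume F: "F \<in> ?m"
        \<comment> \<open>The additive inverse in \<open>?E\<close> has no explicit formula here;
          its constant coefficient is read off from \<open>l_neg\<close>.\<close>
        have "evens (\<ominus>\<^bsub>?E\<^esub> F) 0 \<oplus>\<^bsub>M\<^esub> evens F 0 = \<zero>\<^bsub>M\<^esub>"
          using F arg_cong[OF E.M.l_neg, of F "\<lambda>F. evens F 0"]
          by (simp add: S(6,8) fps_algebra_simps(4,5))
        then show "\<ominus>\<^bsub>?E\<^esub> F \<in> ?m"
          using F ev0[of "\<ominus>\<^bsub>?E\<^esub> F"] by simp
      qed (auto simp: S(8) fps_algebra_simps(5))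
    qed (auto simp: mult0 ev0 E.ring_axioms)
    show "\<one>\<^bsub>?E\<^esub> \<notin> ?m" using assms(1) by (simp add: S(4) fps_algebra_simps(3))
    fix F assume "F \<in> carrier ?E" "F \<notin> ?m"
    then have F: "evens F \<in> carrier (fps_algebra M)" "odds F \<in> inverse_polys M" "evens F 0 \<noteq> \<zero>\<^bsub>M\<^esub>"
      by (simp_all add: S)
    then obtain c where "c \<in> carrier M" "c \<otimes>\<^bsub>M\<^esub> evens F 0 = \<one>\<^bsub>M\<^esub>"
      using units[of "evens F 0"] by (auto simp: fps_algebra_simps)
    then obtain b where b: "b \<in> carrier (fps_algebra M)"
      "evens F \<otimes>\<^bsub>fps_algebra M\<^esub> b = \<one>\<^bsub>fps_algebra M\<^esub>"
      using fps_unit[OF F(1)] by blast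
    \<comment> \<open>\<open>(a, v)\<^sup>-\<^sup>1 = (b, - b\<^sup>2 v)\<close> where \<open>b = a\<^sup>-\<^sup>1\<close>\<close>
    define w where "w = contract M b (contract M b (odds F))"
    have w: "w \<in> inverse_polys M" by (simp add: w_def b F contract_closed)
    let ?n = "\<ominus>\<^bsub>R\<^esub> \<one>\<^bsub>R\<^esub>"
    define G where "G = interleave b (\<lambda>n. ?n \<odot>\<^bsub>M\<^esub> w n)"
    \<comment> \<open>One factor \<open>b\<close> cancels against \<open>a\<close>, so the odd part
      of the product of \<open>G\<close> and \<open>F\<close> is \<open>b v - b v\<close>.\<close>
    have aw: "contract M (evens F) w = contract M b (odds F)"
      unfolding w_def contract_assoc[OF F(1) b(1) contract_closed[OF b(1) F(2)], symmetric]
    by (simp add: b F contract_closed contract_one)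
    have "G \<otimes>\<^bsub>?E\<^esub> F = \<one>\<^bsub>?E\<^esub>"
      by (rule evens_odds_eqI; insert b F w)
        (simp_all add: S G_def P.m_comm[of b] contract_smult_right aw smult_l_minus M.r_neg
          inverse_polys_nth[OF contract_closed])
    moreover have "G \<in> carrier ?E"
      using b w by (simp add: S G_def inverse_polys_smult)
    ultimately show "\<exists>y\<in>carrier ?E. y \<otimes>\<^bsub>?E\<^esub> F = \<one>\<^bsub>?E\<^esub>" by blast
  qed (rule E.is_cring)
qed

section \<open>The ideal of inverse polynomials and its divisibility by the variable\<close>

lemma contract_zero_left:
  "v \<in> inverse_polys M \<Longrightarrow> contract M \<zero>\<^bsub>fps_algebra M\<^esub> v = (\<lambda>n. \<zero>\<^bsub>M\<^esub>)"
  unfolding contract_def by (simp add: fun_eq_iff fps_algebra_simps(4) inverse_polys_nth)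

text \<open>The series is the variable \<open>y\<close>, which moves \<open>y^-n\<close> to
  \<open>y^(1-n)\<close> and kills the constant term; only the summand \<open>i = 1\<close>
  survives.\<close>

lemma contract_var:
  assumes v: "v \<in> inverse_polys M"
  shows "contract M (\<lambda>n. if n = 1 then \<one>\<^bsub>M\<^esub> else \<zero>\<^bsub>M\<^esub>) v = (\<lambda>n. v (Suc n))"
proof
  fix n
  let ?S = "{i. v (n + i) \<noteq> \<zero>\<^bsub>M\<^esub>}"
  obtain d where d: "\<And>n. n > d \<Longrightarrow> v n = \<zero>\<^bsub>M\<^esub>" using inverse_polysE[OF v v] by blast
  have "?S \<subseteq> {..d}"
    using d by (metis (mono_tags, lifting) atMost_iff linorder_not_le mem_Collect_eq subsetI trans_less_add2)
  then have fin: "finite ?S" by (rule finite_subset) simp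
  have "contract M (\<lambda>n. if n = 1 then \<one>\<^bsub>M\<^esub> else \<zero>\<^bsub>M\<^esub>) v n
    = (\<Oplus>\<^bsub>M\<^esub>i\<in>?S. if 1 = i then v (Suc n) else \<zero>\<^bsub>M\<^esub>)"
    unfolding contract_def using inverse_polys_nth[OF v] by (intro M.finsum_cong') auto
  \<comment> \<open>The index 1 is missing from \<open>?S\<close> exactly when
    \<open>v (Suc n)\<close> is zero, so both cases give the same value.\<close>
  also have "\<dots> = v (Suc n)"
  proof (cases "1 \<in> ?S")
    case True
    then show ?thesis using inverse_polys_nth[OF v] fin by (subst M.finsum_singleton) auto
  next
    case False
    then have "(\<Oplus>\<^bsub>M\<^esub>i\<in>?S. if 1 = i then v (Suc n) else \<zero>\<^bsub>M\<^esub>) = (\<Oplus>\<^bsub>M\<^esub>i\<in>?S. \<zero>\<^bsub>M\<^esub>)"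
      by (intro M.finsum_cong') auto
    then show ?thesis using False by simp
  qed
  finally show "contract M (\<lambda>n. if n = 1 then \<one>\<^bsub>M\<^esub> else \<zero>\<^bsub>M\<^esub>) v n = v (Suc n)" .
qed

text \<open>This is the kernel of the projection to power series, the copy of the inverse
  polynomials inside the extension.\<close>

lemma fps_square_zero_ideal:
  "ideal {F \<in> carrier (fps_square_zero M). evens F = \<zero>\<^bsub>fps_algebra M\<^esub>} (fps_square_zero M)"
    (is "ideal ?N ?E")
proof -
  interpret E: algebra R ?E by (rule fps_square_zero_algebra)
  note S = fps_square_zero_simps
  have ev: "evens F \<in> carrier (fps_algebra M)" if "F \<in> carrier ?E" for F
    using that by (simp add: S)
  show ?thesis
  proof (rule idealI)
    show "subgroup ?N (add_monoid ?E)"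
    proof (rule E.M.add.subgroupI)
      show "?N \<noteq> {}" using E.M.zero_closed S(6) by blast
      fix F assume F: "F \<in> ?N"
      have "evens (\<ominus>\<^bsub>?E\<^esub> F) \<oplus>\<^bsub>fps_algebra M\<^esub> evens F = \<zero>\<^bsub>fps_algebra M\<^esub>"
        using F arg_cong[OF E.M.l_neg, of F evens] by (simp add: S(6,8))
      then show "\<ominus>\<^bsub>?E\<^esub> F \<in> ?N" using F ev[of "\<ominus>\<^bsub>?E\<^esub> F"] by simp
    qed (auto simp: S(8))
  qed (auto simp: S(2) ev E.ring_axioms)
qed

lemma fps_square_zero_not_arc_closed:
  assumes "\<one>\<^bsub>M\<^esub> \<noteq> \<zero>\<^bsub>M\<^esub>"
  shows "\<not> arc_closed R (fps_square_zero M)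
    {F \<in> carrier (fps_square_zero M). evens F 0 = \<zero>\<^bsub>M\<^esub>} {\<zero>\<^bsub>fps_square_zero M\<^esub>}"
    (is "\<not> arc_closed R ?E ?m _")
proof -
  interpret E: algebra R ?E by (rule fps_square_zero_algebra)
  note S = fps_square_zero_simps
  let ?N = "{F \<in> carrier ?E. evens F = \<zero>\<^bsub>fps_algebra M\<^esub>}"
  have "?N \<subseteq> arc_closure R ?E ?m {\<zero>\<^bsub>?E\<^esub>}"
  proof (rule divisible_subset_arc_closure[OF fps_square_zero_algebra _ fps_square_zero_ideal])
    fix F assume F: "F \<in> ?N"
    define y where "y = interleave (\<lambda>n. if n = 1 then \<one>\<^bsub>M\<^esub> else \<zero>\<^bsub>M\<^esub>) (\<lambda>n. \<zero>\<^bsub>M\<^esub>)"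
    \<comment> \<open>Shifting up gives a preimage under multiplication by the variable. The value
      at 0 is a free choice, because the variable annihilates that term.\<close>
    define v where "v = (\<lambda>n. case n of 0 \<Rightarrow> \<zero>\<^bsub>M\<^esub> | Suc m \<Rightarrow> odds F m)"
    define G where "G = interleave \<zero>\<^bsub>fps_algebra M\<^esub> v"
    have oF: "odds F \<in> inverse_polys M" using F by (simp add: S)
    obtain d where d: "\<And>n. n > d \<Longrightarrow> odds F n = \<zero>\<^bsub>M\<^esub>" using inverse_polysE[OF oF oF] by blast
    have v: "v \<in> inverse_polys M"
      using oF d by (auto simp: inverse_polys_def v_def split: nat.split intro!: exI[of _ "Suc d"])
    have vSuc: "v (Suc n) = odds F n" for n by (simp add: v_def)
    have yc: "(\<lambda>n. if n = 1 then \<one>\<^bsub>M\<^esub> else \<zero>\<^bsub>M\<^esub>) \<in> carrier (fps_algebra M)"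
      by (simp add: fps_algebra_simps)
    have y: "y \<in> ?m" using yc by (simp add: S y_def inverse_polys_zero)
    have G: "G \<in> ?N" using v by (simp add: S G_def)
    have "F = y \<otimes>\<^bsub>?E\<^esub> G"
      by (rule evens_odds_eqI; insert F v yc oF)
        (simp_all add: S y_def G_def contract_var[simplified] contract_zero_right vSuc inverse_polys_nth[OF oF])
    then show "\<exists>y\<in>?m. \<exists>G\<in>?N. F = y \<otimes>\<^bsub>?E\<^esub> G" using y G by blast
  qed auto
  \<comment> \<open>The inverse polynomial 1 witnesses that the ideal is nonzero.\<close>
  moreover define f where "f = interleave \<zero>\<^bsub>fps_algebra M\<^esub> (\<lambda>n. if n = 0 then \<one>\<^bsub>M\<^esub> else \<zero>\<^bsub>M\<^esub>)"
  have "f \<in> ?N" by (simp add: f_def S inverse_polys_def)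
  moreover have "odds f 0 \<noteq> odds \<zero>\<^bsub>?E\<^esub> 0" using assms by (simp add: f_def S(7))
  then have "f \<noteq> \<zero>\<^bsub>?E\<^esub>" by auto
  ultimately show ?thesis unfolding arc_closed_def by blast
qed

end

text \<open>A ring record need not carry a scalar multiplication, so the field is copied into a
  module record in order to serve as the coefficient algebra.\<close>

definition self_module :: "('k, 'z) ring_scheme \<Rightarrow> ('k, 'k) module" where
  "self_module K = \<lparr>carrier = carrier K, monoid.mult = monoid.mult K, one = one K,
     zero = zero K, add = add K, smult = monoid.mult K\<rparr>"

lemma self_module_simps [simp]:
  "carrier (self_module K) = carrier K" "\<one>\<^bsub>self_module K\<^esub> = \<one>\<^bsub>K\<^esub>" "\<zero>\<^bsub>self_module K\<^esub> = \<zero>\<^bsub>K\<^esub>"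
  "x \<otimes>\<^bsub>self_module K\<^esub> y = x \<otimes>\<^bsub>K\<^esub> y" "x \<oplus>\<^bsub>self_module K\<^esub> y = x \<oplus>\<^bsub>K\<^esub> y"
  "x \<odot>\<^bsub>self_module K\<^esub> y = x \<otimes>\<^bsub>K\<^esub> y"
  by (simp_all add: self_module_def)

lemma (in cring) self_module_algebra: "algebra R (self_module R)"
proof (rule algebraI)
  show "cring (self_module R)"
  proof (rule cringI)
    show "abelian_group (self_module R)"
      by (rule abelian_groupI) (auto simp: a_ac intro: l_neg)
    show "comm_monoid (self_module R)"
      by (rule comm_monoidI) (auto simp: m_ac)
  qed (simp add: l_distr)
qed (auto simp: l_distr r_distr m_assoc cring_axioms)

theorem proposition5p4:
  fixes K :: "('k, 'z) ring_scheme"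
  assumes "field K"
  shows "\<exists>(R :: ('k, nat \<Rightarrow> 'k) module) \<mm>.
    algebra K R \<and> local_ring R \<mm> \<and> \<not> arc_closed K R \<mm> {\<zero>\<^bsub>R\<^esub>}"
proof -
  interpret K: field K by fact
  interpret A: algebra K "self_module K" by (rule K.self_module_algebra)
  have "\<exists>y\<in>carrier K. y \<otimes>\<^bsub>K\<^esub> x = \<one>\<^bsub>K\<^esub>" if "x \<in> carrier K" "x \<noteq> \<zero>\<^bsub>K\<^esub>" for x
    using that K.field_Units K.Units_l_inv_ex by auto
  \<comment> \<open>Unification chooses \<open>fps_square_zero (self_module K)\<close> together with
    the elements of zero constant coefficient.\<close>
  then show ?thesis
    using A.fps_square_zero_algebra A.fps_square_zero_local_ring A.fps_square_zero_not_arc_closed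
    by (intro exI conjI) simp_all
qed

end
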